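(* Let $2<p<\infty$ and let $X$ be a Banach space. Every weakly-$p$-Dunford-Pettis subset of $X$ is weakly precompact.
   Context: A sequence $(x_n)$ in a Banach space $E$ is weakly $p$-summable if $(x^*(x_n))_n\in\ell_p$ for every $x^*\in E^*$. A bounded subset $A$ of $X$ is a weakly-$p$-Dunford-Pettis set if $\sup_{x\in A}|x_n^*(x)|\to 0$ for every weakly $p$-summable sequence $(x_n^* )$ in $X^*$. A subset of $X$ is weakly precompact if every sequence from it has a weakly Cauchy subsequence. *)

theory Defs
  imports "HOL-Analysis.Analysis"
begin

text \<open>Scalars are real; the dual of \<open>'a\<close> is the Banach space \<open>'a \<Rightarrow>\<^sub>L real\<close>.\<close>

definition weakly_p_summable :: "real \<Rightarrow> (nat \<Rightarrow> 'e::real_normed_vector) \<Rightarrow> bool" where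
  "weakly_p_summable p x \<longleftrightarrow>
     (\<forall>f :: 'e \<Rightarrow>\<^sub>L real. summable (\<lambda>n. \<bar>blinfun_apply f (x n)\<bar> powr p))"

text \<open>The supremum is taken in \<open>[0, \<infinity>]\<close>, so that it is \<open>0\<close> for the empty set
  (a supremum over the empty set of reals would be unspecified).\<close>

definition weakly_p_Dunford_Pettis :: "real \<Rightarrow> 'a::real_normed_vector set \<Rightarrow> bool" where
  "weakly_p_Dunford_Pettis p A \<longleftrightarrow> bounded A \<and>
     (\<forall>f :: nat \<Rightarrow> ('a \<Rightarrow>\<^sub>L real). weakly_p_summable p f \<longrightarrow>
        (\<lambda>n. SUP x\<in>A. ennreal \<bar>blinfun_apply (f n) x\<bar>) \<longlonglongrightarrow> 0)"

definition weakly_Cauchy :: "(nat \<Rightarrow> 'a::real_normed_vector) \<Rightarrow> bool" where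
  "weakly_Cauchy x \<longleftrightarrow> (\<forall>f :: 'a \<Rightarrow>\<^sub>L real. Cauchy (\<lambda>n. blinfun_apply f (x n)))"

definition weakly_precompact :: "'a::real_normed_vector set \<Rightarrow> bool" where
  "weakly_precompact A \<longleftrightarrow>
     (\<forall>x :: nat \<Rightarrow> 'a. (\<forall>n. x n \<in> A) \<longrightarrow>
        (\<exists>r :: nat \<Rightarrow> nat. strict_mono r \<and> weakly_Cauchy (x \<circ> r)))"

end

theory Submission
  imports Defs
begin

text \<open>If a bounded sequence has no weakly Cauchy subsequence, then, as in Rosenthal's
  \<open>\<ell>\<^sub>1\<close> theorem, Nash-Williams' theorem yields a subsequence \<open>y\<close> and reals \<open>a < b\<close> such
  that for every set \<open>S\<close> of indices some \<open>g\<^sub>S\<close> in the dual unit ball satisfies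
  \<open>g\<^sub>S (y i) > b\<close> for \<open>i \<in> S\<close> and \<open>g\<^sub>S (y i) < a\<close> for \<open>i \<notin> S\<close>, for all \<open>i < N\<close>.
  Averaging \<open>\<plusminus> g\<^sub>S\<close> over all \<open>S \<subseteq> {..<N}\<close> with the sign of the \<open>n\<close>-th Rademacher function
  gives functionals \<open>f\<^sub>n\<close> with \<open>f\<^sub>n (y n) \<ge> (b - a) / 2\<close> and, by orthogonality, \<open>\<parallel>\<Sum> c\<^sub>n f\<^sub>n\<parallel> \<le> \<parallel>c\<parallel>\<^sub>2\<close>.
  Both bounds survive a weak-* cluster point as \<open>N \<rightarrow> \<infinity>\<close>, and the second makes \<open>f\<close> weakly
  \<open>2\<close>-summable, hence weakly \<open>p\<close>-summable. So the range of \<open>y\<close> is not weakly-\<open>p\<close>-Dunford-Pettis.\<close>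

subsection \<open>The Nash-Williams theorem\<close>

definition above :: "nat set \<Rightarrow> nat set \<Rightarrow> nat set" where
  "above s N = {b \<in> N. \<forall>a\<in>s. a < b}"

lemma infinite_above:
  assumes "finite s" "infinite N"
  shows "infinite (above s N)"
proof -
  obtain k where k: "s \<subseteq> {..<k}"
    using \<open>finite s\<close> finite_nat_iff_bounded by blast
  have "N \<subseteq> {..k} \<union> above s N"
    using k by (force simp: above_def)
  then show ?thesis
    using \<open>infinite N\<close> by (meson finite_UnI finite_atMost finite_subset)
qed

text \<open>Diagonal construction: choose \<open>m 0 < m 1 < ...\<close> together with shrinking
  reservoirs, the \<open>i\<close>-th of which settles \<open>Q\<close> for the finitely many
  \<open>s \<subseteq> {..m i}\<close> in \<open>M\<close>. Everything chosen after
  \<open>Max s\<close> lies in the reservoir belonging to \<open>Max s\<close>, so heredity gives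
  \<open>Q\<close> for the final set.\<close>

lemma fusion:
  fixes Q :: "nat set \<Rightarrow> nat set \<Rightarrow> bool"
  assumes refine: "\<And>s N. \<lbrakk>finite s; s \<subseteq> M; infinite N; N \<subseteq> M\<rbrakk> \<Longrightarrow> \<exists>N'\<subseteq>N. infinite N' \<and> Q s N'"
    and hereditary: "\<And>s N N'. \<lbrakk>Q s N; N' \<subseteq> N; infinite N'\<rbrakk> \<Longrightarrow> Q s N'"
    and "infinite M"
  obtains N where "N \<subseteq> M" "infinite N" "\<And>s. \<lbrakk>finite s; s \<subseteq> N\<rbrakk> \<Longrightarrow> Q s (above s N)"
proof -
  have family: "\<exists>N'\<subseteq>N. infinite N' \<and> (\<forall>s\<in>F. Q s N')"
    if "finite F" "\<forall>s\<in>F. finite s \<and> s \<subseteq> M" "infinite N" "N \<subseteq> M" for F N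
    using that
  proof (induction F)
    case empty
    then show ?case by auto
  next
    case (insert s F)
    then obtain N' where N': "N' \<subseteq> N" "infinite N'" "\<forall>s\<in>F. Q s N'"
      by auto
    then obtain N'' where "N'' \<subseteq> N'" "infinite N''" "Q s N''"
      using refine[of s N'] insert.prems by (meson insertI1 subset_trans)
    then show ?case
      using N' hereditary by (metis insertE subset_trans)
  qed
  \<comment> \<open>The empty set has no maximum, hence no reservoir of its own; it is settled in
    advance.\<close>
  obtain M' where M': "M' \<subseteq> M" "infinite M'" "Q {} M'"
    using refine[of "{}" M] \<open>infinite M\<close> by auto
  define P where "P \<equiv> \<lambda>(_::nat) (m, N). m \<in> M' \<and> infinite N \<and> N \<subseteq> M' \<and> N \<subseteq> {m<..} \<and>
    (\<forall>s. s \<subseteq> {..m} \<inter> M \<longrightarrow> Q s N)"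
  have step: "\<exists>N'. P i (m, N') \<and> N' \<subseteq> N" if "m \<in> M'" "infinite N" "N \<subseteq> M'" for i m N
  proof -
    have "infinite (above {m} N)" "above {m} N \<subseteq> M"
      using that M' infinite_above[of "{m}" N] by (simp, force simp: above_def)
    then obtain N' where "N' \<subseteq> above {m} N" "infinite N'" "\<forall>s\<in>Pow ({..m} \<inter> M). Q s N'"
      using family[of "Pow ({..m} \<inter> M)" "above {m} N"]
      by (metis Pow_iff finite_Int finite_Pow_iff finite_atMost finite_subset le_inf_iff)
    then show ?thesis
      using that unfolding P_def by (intro exI[of _ N']) (auto simp: above_def)
  qed
  have "\<exists>f. \<forall>n. P n (f n) \<and> (fst (f (Suc n)) \<in> snd (f n) \<and> snd (f (Suc n)) \<subseteq> snd (f n))"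
  proof (rule dependent_nat_choice)
    obtain m where "m \<in> M'"
      using M' by (metis finite.emptyI equals0I)
    then show "\<exists>x. P 0 x"
      using step M' by blast
  next
    fix x n assume "P n x"
    then obtain m N where x: "x = (m, N)" and N: "infinite N" "N \<subseteq> M'"
      unfolding P_def by (cases x) auto
    then obtain m' where "m' \<in> N"
      by (metis finite.emptyI equals0I)
    then show "\<exists>y. P (Suc n) y \<and> fst y \<in> snd x \<and> snd y \<subseteq> snd x"
      using step[of m' N "Suc n"] N x by fastforce
  qed
  then obtain f where f: "\<And>n. P n (f n)" "\<And>n. fst (f (Suc n)) \<in> snd (f n)"
      "\<And>n. snd (f (Suc n)) \<subseteq> snd (f n)"
    by blast
  define m where "m = fst \<circ> f"
  have decr: "snd (f j) \<subseteq> snd (f i)" if "i \<le> j" for i j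
    using lift_Suc_antimono_le[of "\<lambda>n. snd (f n)", OF f(3) that] .
  have mem: "m j \<in> snd (f i)" if ij: "i < j" for i j
  proof -
    obtain k where k: "j = Suc k" "i \<le> k"
      using ij by (cases j) auto
    then show ?thesis
      using f(2)[of k] decr[OF k(2)] by (auto simp: m_def)
  qed
  have P: "m i \<in> M'" "snd (f i) \<subseteq> {m i<..}" "\<And>s. s \<subseteq> {..m i} \<inter> M \<Longrightarrow> Q s (snd (f i))" for i
    using f(1)[of i] by (auto simp: P_def m_def split: prod.splits)
  have "strict_mono m"
    using mem P(2) by (meson greaterThan_iff strict_mono_def subsetD)
  have inf: "infinite (range m)"
    using \<open>strict_mono m\<close> by (simp add: range_inj_infinite strict_mono_imp_inj_on)
  show thesis
  proof
    show "range m \<subseteq> M" using P(1) M' by auto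
    show "infinite (range m)" by fact
    fix s assume s: "finite s" "s \<subseteq> range m"
    show "Q s (above s (range m))"
    proof (cases "s = {}")
      case True
      then have "above s (range m) = range m" by (auto simp: above_def)
      with True show ?thesis
        using hereditary[OF M'(3) _ inf] P(1) by auto
    next
      case False
      then obtain i where i: "Max s = m i"
        using s Max_in by (metis imageE subsetD)
      have "above s (range m) \<subseteq> snd (f i)"
      proof
        fix b assume "b \<in> above s (range m)"
        then obtain j where "b = m j" "m i < m j"
          using Max_in[OF s(1) False] by (auto simp: above_def i)
        then show "b \<in> snd (f i)"
          using mem strict_mono_less[OF \<open>strict_mono m\<close>] by auto
      qed
      moreover have "s \<subseteq> {..m i}"
        using Max_ge[OF s(1)] by (auto simp: i)
      moreover have "s \<subseteq> M"
        using s(2) P(1) M'(1) by blast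
      ultimately show ?thesis
        using hereditary[OF P(3)[of s i]] infinite_above[OF s(1) inf] by simp
    qed
  qed
qed

text \<open>Galvin's form of the Nash-Williams theorem, by Nash-Williams' argument of accepted and
  rejected finite sets.\<close>

lemma Nash_Williams:
  fixes F :: "nat set \<Rightarrow> bool"
  assumes "infinite M"
  obtains N where "N \<subseteq> M" "infinite N" "\<And>s. \<lbrakk>finite s; s \<subseteq> N\<rbrakk> \<Longrightarrow> \<not> F s"
  | N where "N \<subseteq> M" "infinite N" "\<And>L. \<lbrakk>infinite L; L \<subseteq> N\<rbrakk> \<Longrightarrow> \<exists>k. F (L \<inter> {..<k})"
proof -
  define acc where "acc s N \<longleftrightarrow>
    (\<forall>L. infinite L \<longrightarrow> L \<subseteq> above s N \<longrightarrow> (\<exists>k. F ((s \<union> L) \<inter> {..<k})))" for s N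
  define rej where "rej s N \<longleftrightarrow> (\<forall>L. infinite L \<longrightarrow> L \<subseteq> N \<longrightarrow> \<not> acc s L)" for s N
  have acc_mono: "acc s N'" if "acc s N" "N' \<subseteq> N" for s N N'
  proof -
    have "above s N' \<subseteq> above s N"
      using that(2) by (auto simp: above_def)
    then show ?thesis
      using that(1) unfolding acc_def by (meson subset_trans)
  qed
  have rej_mono: "rej s N'" if "rej s N" "N' \<subseteq> N" for s N N'
    using that unfolding rej_def by (meson subset_trans)
  have acc_above: "acc s (above s N) \<longleftrightarrow> acc s N" for s N
  proof -
    have "above s (above s N) = above s N" by (auto simp: above_def)
    then show ?thesis by (simp add: acc_def)
  qed
  have rej_above: "rej s N" if "rej s (above s N)" "finite s" for s N
    unfolding rej_def
  proof (intro allI impI notI)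
    fix L assume L: "infinite L" "L \<subseteq> N" "acc s L"
    then have "acc s (above s L)" "infinite (above s L)" "above s L \<subseteq> above s N"
      using acc_above infinite_above that by (auto simp: above_def)
    then show False using that by (auto simp: rej_def)
  qed
  have F_acc: "acc s N" if "F s" "finite s" for s N
    unfolding acc_def
  proof (intro allI impI)
    fix L assume L: "infinite L" "L \<subseteq> above s N"
    then obtain l where l: "l \<in> L" by (metis finite.emptyI equals0I)
    \<comment> \<open>All of \<open>L\<close> lies above \<open>s\<close>, so cutting
      \<open>s \<union> L\<close> at the minimum of \<open>L\<close> leaves exactly
      \<open>s\<close>.\<close>
    define k where "k = (LEAST l. l \<in> L)"
    have "k \<in> L" "\<And>l. l \<in> L \<Longrightarrow> k \<le> l"
      unfolding k_def using l by (auto intro: LeastI Least_le)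
    then have "(s \<union> L) \<inter> {..<k} = s"
      using L by (force simp: above_def)
    then show "\<exists>k. F ((s \<union> L) \<inter> {..<k})" using that by metis
  qed
  \<comment> \<open>By the form of \<open>rej\<close>, an infinite set either rejects
    \<open>s\<close> or has an infinite subset accepting it. So \<open>fusion\<close> yields one
    \<open>M1\<close> that decides all its finite subsets.\<close>
  obtain M1 where M1: "M1 \<subseteq> M" "infinite M1"
    and M1': "\<And>s. \<lbrakk>finite s; s \<subseteq> M1\<rbrakk> \<Longrightarrow> acc s (above s M1) \<or> rej s (above s M1)"
  proof (rule fusion[where Q = "\<lambda>s N. acc s N \<or> rej s N" and M = M])
    fix s N :: "nat set" assume "infinite N"
    then show "\<exists>N'\<subseteq>N. infinite N' \<and> (acc s N' \<or> rej s N')"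
      by (cases "rej s N") (auto simp: rej_def)
  next
    fix s N N' :: "nat set" assume "acc s N \<or> rej s N" "N' \<subseteq> N"
    then show "acc s N' \<or> rej s N'" using acc_mono rej_mono by metis
  qed (use assms in auto)
  have decide: "acc s M1 \<or> rej s M1" if "finite s" "s \<subseteq> M1" for s
    using M1'[OF that] acc_above rej_above that by blast
  show thesis
  proof (cases "acc {} M1")
    case True
    then show ?thesis
      using that(2)[of M1] M1 by (auto simp: acc_def above_def)
  next
    case False
    obtain N where N: "N \<subseteq> M1" "infinite N"
      and N': "\<And>s. \<lbrakk>finite s; s \<subseteq> N\<rbrakk> \<Longrightarrow> rej s M1 \<longrightarrow> (\<forall>n\<in>above s (above s N). rej (insert n s) M1)"
    proof (rule fusion[where M = M1 and
          Q = "\<lambda>s N. rej s M1 \<longrightarrow> (\<forall>n\<in>above s N. rej (insert n s) M1)"])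
      fix s N assume sN: "finite s" "s \<subseteq> M1" "infinite N" "N \<subseteq> M1"
      show "\<exists>N'\<subseteq>N. infinite N' \<and> (rej s M1 \<longrightarrow> (\<forall>n\<in>above s N'. rej (insert n s) M1))"
      proof (cases "rej s M1")
        case True
        \<comment> \<open>\<open>M1\<close> accepts \<open>insert n s\<close> for every
          \<open>n \<in> B\<close>. If \<open>B\<close> were infinite, it would accept
          \<open>s\<close>: a continuation \<open>L\<close> inside \<open>B\<close> starts with some
          \<open>n \<in> B\<close>, and the rest of \<open>L\<close> continues
          \<open>insert n s\<close>. As \<open>s\<close> is rejected, \<open>B\<close> is finite and
          can be discarded.\<close>
        define B where "B = {n \<in> above s N. \<not> rej (insert n s) M1}"
        have "finite B"
        proof (rule ccontr)
          assume "infinite B"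
          have BM: "B \<subseteq> M1" using sN by (auto simp: B_def above_def)
          have "acc s B"
            unfolding acc_def
          proof (intro allI impI)
            fix L assume L: "infinite L" "L \<subseteq> above s B"
            then obtain l where l: "l \<in> L" by (metis finite.emptyI equals0I)
            define n where "n = (LEAST l. l \<in> L)"
            have n: "n \<in> L" "\<And>l. l \<in> L \<Longrightarrow> n \<le> l"
              unfolding n_def using l by (auto intro: LeastI Least_le)
            then have nB: "n \<in> B" using L by (auto simp: above_def)
            then have "acc (insert n s) M1"
              using decide[of "insert n s"] sN BM by (auto simp: B_def)
            moreover have "L - {n} \<subseteq> above (insert n s) M1"
              using L n BM by (force simp: above_def)
            ultimately have "\<exists>k. F ((insert n s \<union> (L - {n})) \<inter> {..<k})"
              using L by (auto simp: acc_def)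
            moreover have "insert n s \<union> (L - {n}) = s \<union> L"
              using n by auto
            ultimately show "\<exists>k. F ((s \<union> L) \<inter> {..<k})" by metis
          qed
          then show False
            using True BM \<open>infinite B\<close> by (auto simp: rej_def)
        qed
        then show ?thesis
          using sN by (intro exI[of _ "N - B"]) (auto simp: B_def above_def)
      qed (use sN in auto)
    next
      fix s N N' assume "rej s M1 \<longrightarrow> (\<forall>n\<in>above s N. rej (insert n s) M1)" "N' \<subseteq> N"
      then show "rej s M1 \<longrightarrow> (\<forall>n\<in>above s N'. rej (insert n s) M1)"
        by (auto simp: above_def)
    qed (use M1 in auto)
    \<comment> \<open>Rejection passes from the empty set to all finite subsets by adding elements
      in increasing order. A member of \<open>F\<close> is accepted outright, so it cannot be
      rejected.\<close>
    have "rej s M1" if "finite s" "s \<subseteq> N" for s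
      using that
    proof (induction s rule: finite_linorder_max_induct)
      case empty
      then show ?case using False decide by auto
    next
      case (insert b A)
      then show ?case using N'[of A] by (auto simp: above_def)
    qed
    then have "\<not> F s" if "finite s" "s \<subseteq> N" for s
      using that F_acc[of s M1] M1 unfolding rej_def by blast
    then show ?thesis
      using that(1)[of N] N M1 by blast
  qed
qed

subsection \<open>Rosenthal's dichotomy\<close>

lemma finite_Diff_above:
  assumes "finite s"
  shows "finite (N - above s N)"
proof -
  have "N - above s N \<subseteq> (\<Union>a\<in>s. {..a})"
    by (auto simp: above_def not_less)
  then show ?thesis
    using assms finite_subset by blast
qed

text \<open>If the liminf were below the limsup, two rationals would fit strictly between them and
  be crossed infinitely often. Rational thresholds leave only countably many pairs for the diagonal
  argument in \<open>oscillating_subsequence\<close>.\<close>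

lemma convergent_if_no_oscillation:
  fixes f :: "nat \<Rightarrow> real"
  assumes bound: "\<And>n. \<bar>f n\<bar> \<le> B"
    and osc: "\<And>a b :: rat. a < b \<Longrightarrow> finite {n. f n > of_rat b} \<or> finite {n. f n < of_rat a}"
  shows "convergent f"
proof -
  let ?g = "\<lambda>n. ereal (f n)"
  have "limsup ?g \<le> liminf ?g"
  proof (rule ccontr)
    assume "\<not> ?thesis"
    then have lt: "liminf ?g < limsup ?g" by simp
    then obtain c where c: "liminf ?g < ereal c" "ereal c < limsup ?g"
      using ereal_dense2 by blast
    then obtain d where d: "ereal c < ereal d" "ereal d < limsup ?g"
      using ereal_dense2 by blast
    obtain a where a: "c < of_rat a" "of_rat a < d"
      using of_rat_dense[of c d] d by auto
    obtain b where b: "of_rat a < real_of_rat b" "of_rat b < d"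
      using of_rat_dense[of "of_rat a" d] a by auto
    have "a < b" using b by (simp add: of_rat_less)
    from osc[OF this] show False
    proof
      assume "finite {n. f n > of_rat b}"
      then have "eventually (\<lambda>n. ?g n \<le> ereal (of_rat b)) sequentially"
        by (simp add: eventually_cofinite cofinite_eq_sequentially[symmetric] not_le)
      then have "limsup ?g \<le> ereal (of_rat b)" by (rule Limsup_bounded)
      also have "\<dots> < ereal d" using b by simp
      finally show False using d by simp
    next
      assume "finite {n. f n < of_rat a}"
      then have "eventually (\<lambda>n. ereal (of_rat a) \<le> ?g n) sequentially"
        by (simp add: eventually_cofinite cofinite_eq_sequentially[symmetric] not_le)
      then have "ereal (of_rat a) \<le> liminf ?g" by (rule Liminf_bounded)
      moreover have "ereal c < ereal (of_rat a)" using a by simp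
      ultimately show False using c by (metis less_le_trans not_less_iff_gr_or_eq)
    qed
  qed
  moreover have "liminf ?g \<le> limsup ?g"
    by (simp add: Liminf_le_Limsup)
  ultimately have lim: "?g \<longlonglongrightarrow> limsup ?g"
    by (simp add: tendsto_iff_Liminf_eq_Limsup)
  have "limsup ?g \<le> ereal B" "ereal (- B) \<le> limsup ?g"
    using bound lim by (auto intro!: Limsup_bounded always_eventually Lim_bounded2[OF lim] simp: abs_le_iff minus_le_iff)
  then obtain l where "limsup ?g = ereal l"
    by (cases "limsup ?g") auto
  then show ?thesis
    using lim by (auto simp: convergent_def)
qed

text \<open>Otherwise every infinite set could be thinned to stop the oscillation across a given
  rational pair at all points of \<open>T\<close> at once. Diagonalizing over the countably many
  pairs would give a subsequence converging at every point of \<open>T\<close>.\<close>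

lemma oscillating_subsequence:
  fixes h :: "nat \<Rightarrow> 't \<Rightarrow> real"
  assumes bound: "\<And>n t. t \<in> T \<Longrightarrow> \<bar>h n t\<bar> \<le> B"
    and div: "\<And>r. strict_mono r \<Longrightarrow> \<exists>t\<in>T. \<not> convergent (\<lambda>n. h (r n) t)"
  obtains a b M where "a < b" "infinite M"
    "\<And>N. \<lbrakk>infinite N; N \<subseteq> M\<rbrakk> \<Longrightarrow>
       \<exists>t\<in>T. infinite {n\<in>N. h n t > b} \<and> infinite {n\<in>N. h n t < a}"
proof (rule ccontr)
  assume no: "\<not> thesis"
  note witness = that
  define good where "good = (\<lambda>(a::rat, b) N. a < b \<longrightarrow>
    (\<forall>t\<in>T. finite {n\<in>N. h n t > of_rat b} \<or> finite {n\<in>N. h n t < of_rat a}))"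
  have ex: "\<exists>N'\<subseteq>N. infinite N' \<and> good q N'" if "infinite N" for q N
  proof (cases q)
    case (Pair a b)
    show ?thesis
    proof (cases "a < b")
      case True
      then have "\<not> (\<forall>N'. infinite N' \<longrightarrow> N' \<subseteq> N \<longrightarrow> (\<exists>t\<in>T. infinite {n\<in>N'. h n t > of_rat b} \<and> infinite {n\<in>N'. h n t < of_rat a}))"
        using no witness[of "of_rat a" "of_rat b" N] \<open>infinite N\<close> by (auto simp: of_rat_less)
      then show ?thesis by (auto simp: good_def Pair)
    qed (use \<open>infinite N\<close> in \<open>auto simp: good_def Pair\<close>)
  qed
  have good_mono: "good q N'" if "good q N" "finite (N' - N)" for q N N'
  proof -
    have *: "finite {n\<in>N'. P n}" if "finite {n\<in>N. P n}" for P
      using that \<open>finite (N' - N)\<close>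
      by (rule_tac finite_subset[of _ "{n\<in>N. P n} \<union> (N' - N)"]) auto
    then show ?thesis
      using that(1) unfolding good_def by (auto split: prod.splits)
  qed
  \<comment> \<open>\<open>fusion\<close> is indexed by finite sets, so \<open>card s\<close> serves
    as the code of a rational pair: any \<open>s \<subseteq> N\<close> with \<open>to_nat q\<close>
    elements settles \<open>q\<close> on \<open>above s N\<close>, and \<open>good\<close> does not
    see the finitely many other elements of \<open>N\<close>.\<close>
  obtain N where N: "infinite N"
    and N': "\<And>s. \<lbrakk>finite s; s \<subseteq> N\<rbrakk> \<Longrightarrow> good (from_nat (card s)) (above s N)"
  proof (rule fusion[where M = UNIV and Q = "\<lambda>s. good (from_nat (card s))"])
    fix s N N' :: "nat set" assume "good (from_nat (card s)) N" "N' \<subseteq> N"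
    moreover have "N' - N = {}" using \<open>N' \<subseteq> N\<close> by auto
    ultimately show "good (from_nat (card s)) N'" using good_mono by (metis finite.emptyI)
  qed (use ex in auto)
  have good: "good q N" for q
  proof -
    obtain s where s: "s \<subseteq> N" "finite s" "card s = to_nat q"
      using infinite_arbitrarily_large[OF N] by metis
    then have "good q (above s N)"
      using N'[of s] by simp
    then show ?thesis
      using good_mono finite_Diff_above s by blast
  qed
  let ?r = "enumerate N"
  have r: "strict_mono ?r" "range ?r = N"
    using N by (auto simp: strict_mono_enumerate range_enumerate)
  then obtain t where t: "t \<in> T" "\<not> convergent (\<lambda>n. h (?r n) t)"
    using div by blast
  have fin: "finite {n. P (?r n)}" if "finite {n\<in>N. P n}" for P
  proof -
    have "{n. P (?r n)} \<subseteq> ?r -` {n\<in>N. P n}" using r by auto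
    moreover have "finite (?r -` {n\<in>N. P n})"
      using that finite_vimageI strict_mono_imp_inj_on[OF r(1)] by blast
    ultimately show ?thesis by (rule finite_subset)
  qed
  have "convergent (\<lambda>n. h (?r n) t)"
  proof (rule convergent_if_no_oscillation)
    fix a b :: rat assume "a < b"
    then have "finite {n\<in>N. h n t > of_rat b} \<or> finite {n\<in>N. h n t < of_rat a}"
      using good[of "(a, b)"] t by (auto simp: good_def)
    then show "finite {n. h (?r n) t > of_rat b} \<or> finite {n. h (?r n) t < of_rat a}"
      using fin[of "\<lambda>n. h n t > of_rat b"] fin[of "\<lambda>n. h n t < of_rat a"] by blast
  qed (use bound t in auto)
  then show False using t by simp
qed

lemma alternating_subsequence:
  fixes P Q :: "nat \<Rightarrow> bool"
  assumes "infinite {n\<in>M. P n}" "infinite {n\<in>M. Q n}"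
  obtains m where "strict_mono m" "range m \<subseteq> M" "\<And>i::nat. if even i then P (m i) else Q (m i)"
proof -
  have "\<exists>m. \<forall>i. (m i \<in> M \<and> (if even i then P (m i) else Q (m i))) \<and> m i < m (Suc i)"
  proof (rule dependent_nat_choice)
    obtain n where "n \<in> {n\<in>M. P n}"
      using assms(1) by (metis finite.emptyI equals0I)
    then show "\<exists>n. n \<in> M \<and> (if even (0::nat) then P n else Q n)" by auto
  next
    fix k i :: nat
    obtain n n' where "n \<in> {n\<in>M. P n}" "k < n" "n' \<in> {n\<in>M. Q n}" "k < n'"
      using assms by (meson infinite_nat_iff_unbounded)
    then show "\<exists>n. (n \<in> M \<and> (if even (Suc i) then P n else Q n)) \<and> k < n"
      by (cases "even i") auto
  qed
  then show thesis
    using that by (auto simp: strict_mono_Suc_iff image_subset_iff)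
qed

lemma card_less_strict_mono:
  fixes m :: "nat \<Rightarrow> nat"
  assumes "strict_mono m"
  shows "card {x \<in> range m. x < m i} = i"
proof -
  have "{x \<in> range m. x < m i} = m ` {..<i}"
    using assms by (auto simp: strict_mono_less)
  then show ?thesis
    using assms by (simp add: card_image strict_mono_imp_inj_on inj_on_subset[OF _ subset_UNIV])
qed

text \<open>The odd-indexed terms are the ones of interest; the even-indexed terms serve as fillers that
  shift the parity of the positions after them. This turns alternating patterns into arbitrary ones.\<close>

lemma prescribed_parity:
  fixes m :: "nat \<Rightarrow> nat"
  assumes m: "strict_mono m"
  shows "\<exists>s. s \<subseteq> m ` {..<2*k} \<and>
    (\<forall>i<k. m (2*i+1) \<in> s \<and> (even (card {x\<in>s. x < m (2*i+1)}) \<longleftrightarrow> i \<in> S))"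
proof (induction k)
  case 0
  then show ?case by auto
next
  case (Suc k)
  then obtain s where s: "s \<subseteq> m ` {..<2*k}"
    and par: "\<And>i. i < k \<Longrightarrow> m (2*i+1) \<in> s \<and> (even (card {x\<in>s. x < m (2*i+1)}) \<longleftrightarrow> i \<in> S)"
    by blast
  have fin: "finite s" using s finite_subset by blast
  have less: "x < m j" if "x \<in> s" "2*k \<le> j" for x j
  proof -
    obtain i where "x = m i" "i < 2*k" using s \<open>x \<in> s\<close> by auto
    then show ?thesis using \<open>2*k \<le> j\<close> m by (simp add: strict_mono_less)
  qed
  have notin: "m (2*k) \<notin> s" using less by fastforce
  \<comment> \<open>Without the filler \<open>m (2*k)\<close>, exactly \<open>card s\<close> chosen
    elements precede \<open>m (2*k+1)\<close>; the filler adds one and is inserted when the parity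
    is wrong. Both lie above \<open>s\<close>, so earlier counts do not change.\<close>
  define s' where "s' = (if even (card s) \<longleftrightarrow> k \<in> S then {m (2*k+1)} else {m (2*k), m (2*k+1)})"
  have s': "s' \<subseteq> m ` {2*k..<2*Suc k}" by (auto simp: s'_def)
  have "m (2*i+1) \<in> s \<union> s' \<and> (even (card {x\<in>s \<union> s'. x < m (2*i+1)}) \<longleftrightarrow> i \<in> S)" if "i < Suc k" for i
  proof (cases "i < k")
    case True
    have "{x\<in>s \<union> s'. x < m (2*i+1)} = {x\<in>s. x < m (2*i+1)}"
      using s' True m by (auto simp: strict_mono_less)
    then show ?thesis using par[OF True] by simp
  next
    case False
    then have i: "i = k" using that by simp
    have "{x\<in>s \<union> s'. x < m (2*k+1)} = (if even (card s) \<longleftrightarrow> k \<in> S then s else insert (m (2*k)) s)"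
      using less[of _ "2*k+1"] strict_mono_less[OF m] by (auto simp: s'_def)
    then show ?thesis
      using notin fin by (auto simp: i s'_def)
  qed
  moreover have "s \<union> s' \<subseteq> m ` {..<2 * Suc k}"
    using s s' by fastforce
  ultimately show ?case by blast
qed

text \<open>Nash-Williams is applied to the finite \<open>s\<close> on which no \<open>t\<close>
  follows the pattern above \<open>b\<close>, below \<open>a\<close>, above \<open>b\<close>, and so
  on. A point oscillating on \<open>N\<close> follows it along an alternating subsequence, which
  excludes the second alternative. Hence all finite subsets of some infinite set admit the
  alternating pattern, and parity shifts turn it into every pattern on the odd-indexed
  terms.\<close>

lemma Rosenthal_independent_subsequence:
  fixes h :: "nat \<Rightarrow> 't \<Rightarrow> real"
  assumes bound: "\<And>n t. t \<in> T \<Longrightarrow> \<bar>h n t\<bar> \<le> B"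
    and div: "\<And>r. strict_mono r \<Longrightarrow> \<exists>t\<in>T. \<not> convergent (\<lambda>n. h (r n) t)"
  obtains a b and u :: "nat \<Rightarrow> nat" where "a < b" "strict_mono u"
    "\<And>k S. \<exists>t\<in>T. \<forall>i<k. if i \<in> S then h (u i) t > b else h (u i) t < a"
proof -
  obtain a b M where "a < b" "infinite M"
    and osc: "\<And>N. \<lbrakk>infinite N; N \<subseteq> M\<rbrakk> \<Longrightarrow>
       \<exists>t\<in>T. infinite {n\<in>N. h n t > b} \<and> infinite {n\<in>N. h n t < a}"
    by (rule oscillating_subsequence[of T h B, OF bound div]) (assumption, assumption, rule that)
  define R where "R s t \<longleftrightarrow> (\<forall>n\<in>s. if even (card {m\<in>s. m < n}) then h n t > b else h n t < a)"
    for s t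
  obtain N where N: "infinite N" "N \<subseteq> M" and R: "\<And>s. \<lbrakk>finite s; s \<subseteq> N\<rbrakk> \<Longrightarrow> \<exists>t\<in>T. R s t"
  proof (rule Nash_Williams[OF \<open>infinite M\<close>, of "\<lambda>s. \<not> (\<exists>t\<in>T. R s t)"])
    fix N assume N: "N \<subseteq> M" "infinite N"
      and bad: "\<And>L. \<lbrakk>infinite L; L \<subseteq> N\<rbrakk> \<Longrightarrow> \<exists>k. \<not> (\<exists>t\<in>T. R (L \<inter> {..<k}) t)"
    obtain t where t: "t \<in> T" "infinite {n\<in>N. h n t > b}" "infinite {n\<in>N. h n t < a}"
      using osc N by blast
    obtain m where m: "strict_mono m" "range m \<subseteq> N"
      and alt: "\<And>i::nat. if even i then h (m i) t > b else h (m i) t < a"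
      by (rule alternating_subsequence[OF t(2,3)]) (rule that)
    have "R (range m \<inter> {..<k}) t" for k
      unfolding R_def
    proof
      fix n assume "n \<in> range m \<inter> {..<k}"
      then obtain i where i: "n = m i" "m i < k" by auto
      then have "{x \<in> range m \<inter> {..<k}. x < n} = {x \<in> range m. x < m i}" by auto
      then show "if even (card {x \<in> range m \<inter> {..<k}. x < n}) then h n t > b else h n t < a"
        using alt[of i] card_less_strict_mono[OF m(1)] i by simp
    qed
    moreover have "infinite (range m)"
      using m by (simp add: range_inj_infinite strict_mono_imp_inj_on)
    ultimately show thesis
      using bad[of "range m"] m t by blast
  qed blast
  define m where "m = enumerate N"
  have m: "strict_mono m" "range m = N"
    using N by (auto simp: m_def strict_mono_enumerate range_enumerate)
  show thesis
  proof
    show "a < b" by fact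
    show "strict_mono (\<lambda>i. m (2*i+1))"
      using m(1) by (simp add: strict_mono_def)
    fix k S
    obtain s where s: "s \<subseteq> m ` {..<2*k}"
      and par: "\<And>i. i < k \<Longrightarrow> m (2*i+1) \<in> s \<and> (even (card {x\<in>s. x < m (2*i+1)}) \<longleftrightarrow> i \<in> S)"
      using prescribed_parity[OF m(1), of k S] by blast
    have "finite s" "s \<subseteq> N"
      using s m(2) finite_subset by blast+
    then obtain t where "t \<in> T" "R s t" using R by blast
    then show "\<exists>t\<in>T. \<forall>i<k. if i \<in> S then h (m (2*i+1)) t > b else h (m (2*i+1)) t < a"
      using par by (intro bexI[of _ t]) (auto simp: R_def)
  qed
qed

subsection \<open>Rademacher averages of functionals\<close>

text \<open>The subsets of \<open>{..<N}\<close> model the sign vectors of length \<open>N\<close>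
  with equal weights; \<open>rad n\<close> is the \<open>n\<close>-th coordinate, that is, the
  \<open>n\<close>-th Rademacher function.\<close>

definition rad :: "nat \<Rightarrow> nat set \<Rightarrow> real" where
  "rad n S = (if n \<in> S then 1 else - 1)"

lemma sum_Pow_lessThan_Suc:
  "(\<Sum>S\<in>Pow {..<Suc n}. \<phi> S) = (\<Sum>S\<in>Pow {..<n}. \<phi> S + \<phi> (insert n S))"
  for \<phi> :: "nat set \<Rightarrow> 'b::comm_monoid_add"
proof -
  have "inj_on (insert n) (Pow {..<n})"
    by (rule inj_onI) (auto simp: insert_ident)
  moreover have "Pow {..<n} \<inter> insert n ` Pow {..<n} = {}"
    by auto
  ultimately show ?thesis
    by (simp add: lessThan_Suc Pow_insert sum.union_disjoint sum.reindex sum.distrib)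
qed

text \<open>Orthogonality of the Rademacher functions. In the induction, \<open>S\<close> and
  \<open>insert N S\<close> share the first \<open>N\<close> terms and have opposite last terms, so
  the cross terms cancel when the two squares are added.\<close>

lemma sum_Pow_rad_squares:
  "(\<Sum>S\<in>Pow {..<N}. (\<Sum>n<N. c n * rad n S)\<^sup>2) = 2 ^ N * (\<Sum>n<N. (c n)\<^sup>2)"
proof (induction N)
  case 0
  then show ?case by simp
next
  case (Suc N)
  have "(\<Sum>n<Suc N. c n * rad n S)\<^sup>2 + (\<Sum>n<Suc N. c n * rad n (insert N S))\<^sup>2
      = 2 * (\<Sum>n<N. c n * rad n S)\<^sup>2 + 2 * (c N)\<^sup>2" if "S \<subseteq> {..<N}" for S
  proof -
    have "(\<Sum>n<N. c n * rad n (insert N S)) = (\<Sum>n<N. c n * rad n S)"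
      by (rule sum.cong) (auto simp: rad_def)
    moreover have "rad N S = - 1" "rad N (insert N S) = 1"
      using that by (auto simp: rad_def)
    ultimately show ?thesis
      by (simp add: power2_eq_square algebra_simps)
  qed
  then have "(\<Sum>S\<in>Pow {..<Suc N}. (\<Sum>n<Suc N. c n * rad n S)\<^sup>2)
      = (\<Sum>S\<in>Pow {..<N}. 2 * (\<Sum>n<N. c n * rad n S)\<^sup>2 + 2 * (c N)\<^sup>2)"
    unfolding sum_Pow_lessThan_Suc by (intro sum.cong) auto
  also have "\<dots> = 2 * (2 ^ N * (\<Sum>n<N. (c n)\<^sup>2)) + 2 ^ N * (2 * (c N)\<^sup>2)"
    by (simp add: sum.distrib sum_distrib_left[symmetric] Suc.IH card_Pow del: sum_distrib_left)
  finally show ?case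
    by (simp add: algebra_simps)
qed

lemma sum_Pow_if_mem:
  assumes "n < N"
  shows "(\<Sum>S\<in>Pow {..<N}. if n \<in> S then b else c) = 2 ^ N * ((b + c) / 2 :: real)"
  using assms
proof (induction N)
  case 0
  then show ?case by simp
next
  case (Suc N)
  show ?case
  proof (cases "n = N")
    case True
    have "(\<Sum>S\<in>Pow {..<Suc N}. if n \<in> S then b else c) = (\<Sum>S\<in>Pow {..<N}. b + c)"
      unfolding sum_Pow_lessThan_Suc using True by (intro sum.cong) auto
    then show ?thesis by (simp add: card_Pow)
  next
    case False
    have "(\<Sum>S\<in>Pow {..<Suc N}. if n \<in> S then b else c) = (\<Sum>S\<in>Pow {..<N}. 2 * (if n \<in> S then b else c))"
      unfolding sum_Pow_lessThan_Suc using False by (intro sum.cong) auto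
    also have "\<dots> = 2 * (\<Sum>S\<in>Pow {..<N}. if n \<in> S then b else c)"
      by (rule sum_distrib_left[symmetric])
    finally show ?thesis using Suc False by simp
  qed
qed

text \<open>Exchanging the sums writes the combination as the average over \<open>S\<close> of
  \<open>X S * g S x\<close>. Cauchy-Schwarz separates the factors: orthogonality evaluates the mean
  square of \<open>X\<close>, and the norm bound on \<open>g S\<close> controls the other
  factor.\<close>

lemma Rademacher_average:
  fixes g :: "nat set \<Rightarrow> ('a::real_normed_vector \<Rightarrow>\<^sub>L real)"
  defines "f N n \<equiv> (1 / 2 ^ N) *\<^sub>R (\<Sum>S\<in>Pow {..<N}. rad n S *\<^sub>R g S)"
  assumes norm: "\<And>S. norm (g S) \<le> 1"
  shows "(\<Sum>n<N. c n * f N n x)\<^sup>2 \<le> (\<Sum>n<N. (c n)\<^sup>2) * (norm x)\<^sup>2"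
proof -
  define X where "X S = (\<Sum>n<N. c n * rad n S)" for S
  have f: "f N n x = (1 / 2 ^ N) * (\<Sum>S\<in>Pow {..<N}. rad n S * g S x)" for n
    by (simp add: f_def blinfun.scaleR_left blinfun.sum_left)
  have "(\<Sum>n<N. c n * f N n x) = (1 / 2 ^ N) * (\<Sum>n<N. \<Sum>S\<in>Pow {..<N}. c n * rad n S * g S x)"
    by (simp add: f sum_distrib_left mult_ac)
  also have "(\<Sum>n<N. \<Sum>S\<in>Pow {..<N}. c n * rad n S * g S x) = (\<Sum>S\<in>Pow {..<N}. X S * g S x)"
    by (subst sum.swap) (simp add: X_def sum_distrib_right)
  finally have "(\<Sum>n<N. c n * f N n x)\<^sup>2 = (1 / 2 ^ N)\<^sup>2 * (\<Sum>S\<in>Pow {..<N}. X S * g S x)\<^sup>2"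
    by (simp add: power_mult_distrib power_divide)
  also have "\<dots> \<le> (1 / 2 ^ N)\<^sup>2 * ((\<Sum>S\<in>Pow {..<N}. (X S)\<^sup>2) * (\<Sum>S\<in>Pow {..<N}. (g S x)\<^sup>2))"
    by (intro mult_left_mono Cauchy_Schwarz_ineq_sum) simp
  also have "\<dots> \<le> (1 / 2 ^ N)\<^sup>2 * ((\<Sum>S\<in>Pow {..<N}. (X S)\<^sup>2) * (\<Sum>S\<in>Pow {..<N}. (norm x)\<^sup>2))"
  proof (intro mult_left_mono sum_mono)
    fix S
    have "norm (g S x) \<le> 1 * norm x"
      by (rule order_trans[OF norm_blinfun mult_right_mono[OF norm norm_ge_zero]])
    then show "(g S x)\<^sup>2 \<le> (norm x)\<^sup>2"
      using abs_le_square_iff[of "g S x" "norm x"] by simp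
  qed (auto intro: sum_nonneg)
  also have "\<dots> = (1 / 2 ^ N)\<^sup>2 * (2 ^ N * (\<Sum>n<N. (c n)\<^sup>2) * (2 ^ N * (norm x)\<^sup>2))"
    unfolding X_def sum_Pow_rad_squares by (simp add: card_Pow)
  also have "\<dots> = (\<Sum>n<N. (c n)\<^sup>2) * (norm x)\<^sup>2"
    by (simp add: power2_eq_square field_simps)
  finally show ?thesis .
qed

section \<open>Weak-* cluster points of the averages\<close>

lemma compact_cluster_point:
  fixes G :: "nat \<Rightarrow> 'b::topological_space"
  assumes "compact K" "\<And>N. G N \<in> K"
  obtains g where "\<And>C. \<lbrakk>closed C; eventually (\<lambda>N. G N \<in> C) sequentially\<rbrakk> \<Longrightarrow> g \<in> C"
proof -
  \<comment> \<open>A cluster point of the image filter is used because a compact product of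
    uncountably many intervals need not be sequentially compact.\<close>
  let ?F = "filtermap G sequentially"
  have "?F \<noteq> bot" "eventually (\<lambda>x. x \<in> K) ?F"
    using assms by (auto simp: filtermap_bot_iff eventually_filtermap)
  then obtain g where g: "inf (nhds g) ?F \<noteq> bot"
    using assms(1) unfolding compact_filter by blast
  show thesis
  proof
    fix C assume C: "closed C" "eventually (\<lambda>N. G N \<in> C) sequentially"
    show "g \<in> C"
    proof (rule ccontr)
      assume "g \<notin> C"
      then have "eventually (\<lambda>x. x \<in> - C) (nhds g)"
        using C by (intro eventually_nhds_in_open) auto
      moreover have "eventually (\<lambda>x. x \<in> C) ?F"
        using C by (simp add: eventually_filtermap)
      ultimately have "eventually (\<lambda>x. False) (inf (nhds g) ?F)"
        unfolding eventually_inf by (intro exI conjI) auto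
      then show False using g by (simp add: trivial_limit_def)
    qed
  qed
qed

lemma weakly_2_summable_limit:
  fixes y :: "nat \<Rightarrow> 'a::real_normed_vector"
  assumes indep: "\<And>N S. \<exists>g :: 'a \<Rightarrow>\<^sub>L real. norm g \<le> 1 \<and> (\<forall>i<N. if i \<in> S then b < blinfun_apply g (y i) else blinfun_apply g (y i) < a)"
  obtains f :: "nat \<Rightarrow> ('a \<Rightarrow>\<^sub>L real)" where
    "\<And>N c x. (\<Sum>n<N. c n * f n x)\<^sup>2 \<le> (\<Sum>n<N. (c n)\<^sup>2) * (norm x)\<^sup>2"
    "\<And>n. f n (y n) \<ge> (b - a) / 2"
proof -
  obtain g :: "nat \<Rightarrow> nat set \<Rightarrow> ('a \<Rightarrow>\<^sub>L real)" where g: "\<And>N S. norm (g N S) \<le> 1"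
    "\<And>N S i. i < N \<Longrightarrow> if i \<in> S then b < g N S (y i) else g N S (y i) < a"
    using indep by metis
  define f where "f N n = (1 / 2 ^ N) *\<^sub>R (\<Sum>S\<in>Pow {..<N}. rad n S *\<^sub>R g N S)" for N n
  \<comment> \<open>The whole \<open>N\<close>-th family becomes one point of a product over pairs
    \<open>(n, x)\<close>, so one compactness argument gives all limits at once. The default 0 for
    \<open>n \<ge> N\<close> is linear in \<open>x\<close> and respects the norm bound; for fixed
    \<open>n\<close> it disappears once \<open>N > n\<close>.\<close>
  define G where "G N = (\<lambda>(n, x). if n < N then f N n x else 0)" for N
  have f2: "(\<Sum>n<N. c n * f N n x)\<^sup>2 \<le> (\<Sum>n<N. (c n)\<^sup>2) * (norm x)\<^sup>2" for N c x
    using Rademacher_average[of "g N", OF g(1)] unfolding f_def .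
  have G2: "(\<Sum>n<k. c n * G N (n, x))\<^sup>2 \<le> (\<Sum>n<k. (c n)\<^sup>2) * (norm x)\<^sup>2" if "k \<le> N" for k N c x
  proof -
    let ?c = "\<lambda>n. if n < k then c n else 0"
    have "(\<Sum>n<k. c n * G N (n, x)) = (\<Sum>n<N. ?c n * f N n x)"
      using that by (intro sum.mono_neutral_cong_left) (auto simp: G_def)
    moreover have "(\<Sum>n<k. (c n)\<^sup>2) = (\<Sum>n<N. (?c n)\<^sup>2)"
      using that by (intro sum.mono_neutral_cong_left) auto
    ultimately show ?thesis using f2[where c = ?c] by simp
  qed
  have Gle: "\<bar>G N (n, x)\<bar> \<le> norm x" for N n x
  proof (cases "n < N")
    case True
    \<comment> \<open>A unit coefficient vector singles out one functional and bounds its norm by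
      1.\<close>
    let ?c = "\<lambda>i. if i = n then 1 else 0 :: real"
    have "(\<Sum>i<N. ?c i * f N i x) = G N (n, x)" "(\<Sum>i<N. (?c i)\<^sup>2) = 1"
      using True by (simp_all add: G_def if_distrib[of "\<lambda>t. t * _"] if_distrib[of "\<lambda>t. t\<^sup>2"] cong: if_cong)
    then have "(G N (n, x))\<^sup>2 \<le> (norm x)\<^sup>2"
      using f2[where c = ?c and N = N and x = x] by simp
    then show ?thesis by (simp add: abs_le_square_iff[symmetric])
  qed (simp add: G_def)
  have Gy: "G N (n, y n) \<ge> (b - a) / 2" if "n < N" for n N
  proof -
    \<comment> \<open>A set \<open>S\<close> containing \<open>n\<close> contributes more than
      \<open>b\<close>, any other one more than \<open>- a\<close> because of the sign. Both kinds
      are equally frequent, hence the mean \<open>(b - a) / 2\<close>.\<close>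
    have "2 ^ N * ((b - a) / 2) = (\<Sum>S\<in>Pow {..<N}. if n \<in> S then b else - a)"
      using sum_Pow_if_mem[OF that, of b "- a"] by simp
    also have "\<dots> \<le> (\<Sum>S\<in>Pow {..<N}. rad n S * g N S (y n))"
    proof (rule sum_mono)
      fix S
      show "(if n \<in> S then b else - a) \<le> rad n S * g N S (y n)"
        using g(2)[OF that, of S] by (simp add: rad_def split: if_splits)
    qed
    finally show ?thesis
      using that by (simp add: G_def f_def blinfun.scaleR_left blinfun.sum_left field_simps)
  qed
  \<comment> \<open>Tychonoff's theorem for this product plays the role of Banach-Alaoglu. Each
    property passed on to \<open>h\<close> is a closed condition on finitely many
    coordinates.\<close>
  define K where "K = PiE UNIV (\<lambda>(n::nat, x::'a). {- norm x..norm x})"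
  have "compact K"
    using compactin_PiE[of "\<lambda>_. euclidean" UNIV "\<lambda>(n::nat, x::'a). {- norm x..norm x}"]
    by (auto simp: K_def euclidean_product_topology split: prod.splits)
  moreover have "G N \<in> K" for N
    using Gle by (auto simp: K_def abs_le_iff minus_le_iff)
  ultimately obtain h where h: "\<And>C. \<lbrakk>closed C; eventually (\<lambda>N. G N \<in> C) sequentially\<rbrakk> \<Longrightarrow> h \<in> C"
    using compact_cluster_point by blast
  have "h \<in> {h. h (n, x + z) = h (n, x) + h (n, z)}" for n x z
    by (rule h) (auto intro!: closed_Collect_eq continuous_intros simp: G_def blinfun.add_right)
  then have add: "h (n, x + z) = h (n, x) + h (n, z)" for n x z by blast
  have "h \<in> {h. h (n, r *\<^sub>R x) = r * h (n, x)}" for n r x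
    by (rule h) (auto intro!: closed_Collect_eq continuous_intros simp: G_def blinfun.scaleR_right)
  then have scale: "h (n, r *\<^sub>R x) = r * h (n, x)" for n r x by blast
  have "h \<in> {h. \<bar>h (n, x)\<bar> \<le> norm x}" for n x
    using Gle by (intro h) (auto intro!: closed_Collect_le continuous_intros)
  then have bound: "\<bar>h (n, x)\<bar> \<le> norm x" for n x by blast
  have "h \<in> {h. (\<Sum>n<k. c n * h (n, x))\<^sup>2 \<le> (\<Sum>n<k. (c n)\<^sup>2) * (norm x)\<^sup>2}" for k c x
    using G2 by (intro h eventually_sequentiallyI[of k]) (auto intro!: closed_Collect_le continuous_intros)
  then have h2: "(\<Sum>n<k. c n * h (n, x))\<^sup>2 \<le> (\<Sum>n<k. (c n)\<^sup>2) * (norm x)\<^sup>2" for k c x by blast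
  have "h \<in> {h. (b - a) / 2 \<le> h (n, y n)}" for n
    using Gy by (intro h eventually_sequentiallyI[of "Suc n"]) (auto intro!: closed_Collect_le continuous_intros)
  then have hy: "(b - a) / 2 \<le> h (n, y n)" for n by blast
  have "bounded_linear (\<lambda>x. h (n, x))" for n
    by (rule bounded_linear_intro[where K = 1]) (use add scale bound in auto)
  then have Bl: "Blinfun (\<lambda>x. h (n, x)) x = h (n, x)" for n x
    by (simp add: bounded_linear_Blinfun_apply)
  show thesis
    by (rule that[of "\<lambda>n. Blinfun (\<lambda>x. h (n, x))"]) (use h2 hy in \<open>simp_all add: Bl\<close>)
qed

section \<open>Weak p-summability by duality\<close>

lemma weakly_p_summableI:
  fixes f :: "nat \<Rightarrow> ('a::real_normed_vector \<Rightarrow>\<^sub>L real)"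
  assumes "2 \<le> p"
    and f2: "\<And>N c x. (\<Sum>n<N. c n * f n x)\<^sup>2 \<le> (\<Sum>n<N. (c n)\<^sup>2) * (norm x)\<^sup>2"
  shows "weakly_p_summable p f"
  unfolding weakly_p_summable_def
proof
  fix \<phi> :: "('a \<Rightarrow>\<^sub>L real) \<Rightarrow>\<^sub>L real"
  \<comment> \<open>Testing \<open>\<phi>\<close> on \<open>F\<close>, the combination with
    coefficients \<open>\<phi> (f n)\<close>, gives
    \<open>s = \<phi> F \<le> norm \<phi> * sqrt s\<close>, since \<open>f2\<close> bounds
    \<open>norm F\<close> by \<open>sqrt s\<close>. Cancelling \<open>sqrt s\<close> leaves the
    claim.\<close>
  have partial: "(\<Sum>n<N. (\<phi> (f n))\<^sup>2) \<le> (norm \<phi>)\<^sup>2" for N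
  proof -
    define s where "s = (\<Sum>n<N. (\<phi> (f n))\<^sup>2)"
    define F where "F = (\<Sum>n<N. \<phi> (f n) *\<^sub>R f n)"
    have "s \<ge> 0" by (simp add: s_def sum_nonneg)
    have "norm F \<le> sqrt s"
    proof (rule norm_blinfun_bound)
      fix x
      have "(F x)\<^sup>2 \<le> s * (norm x)\<^sup>2"
        using f2[where c = "\<lambda>n. \<phi> (f n)" and N = N and x = x] by (simp add: F_def s_def blinfun.sum_left blinfun.scaleR_left)
      then have "(F x)\<^sup>2 \<le> (sqrt s * norm x)\<^sup>2"
        using \<open>s \<ge> 0\<close> by (simp add: power_mult_distrib)
      then show "norm (F x) \<le> sqrt s * norm x"
        using \<open>s \<ge> 0\<close> abs_le_square_iff[of "F x" "sqrt s * norm x"] by (simp add: abs_mult)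
    qed (use \<open>s \<ge> 0\<close> in simp)
    have "s = \<phi> F"
      by (simp add: s_def F_def blinfun.sum_right blinfun.scaleR_right power2_eq_square)
    also have "\<dots> \<le> norm \<phi> * norm F"
      using norm_blinfun[of \<phi> F] by simp
    also have "\<dots> \<le> norm \<phi> * sqrt s"
      using \<open>norm F \<le> sqrt s\<close> by (intro mult_left_mono) auto
    finally have "sqrt s * sqrt s \<le> norm \<phi> * sqrt s"
      using \<open>s \<ge> 0\<close> by simp
    then have "sqrt s \<le> norm \<phi>"
      using mult_right_le_imp_le[of "sqrt s" "sqrt s" "norm \<phi>"] \<open>s \<ge> 0\<close>
      by (cases "s = 0") auto
    then show ?thesis
      using \<open>s \<ge> 0\<close> power_mono[of "sqrt s" "norm \<phi>" 2] by (simp add: s_def)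
  qed
  have sq: "summable (\<lambda>n. (\<phi> (f n))\<^sup>2)"
  proof (rule bounded_imp_summable)
    show "(\<Sum>n\<le>N. (\<phi> (f n))\<^sup>2) \<le> (norm \<phi>)\<^sup>2" for N
      using partial[of "Suc N"] by (simp only: lessThan_Suc_atMost)
  qed simp
  then have "(\<lambda>n. (\<phi> (f n))\<^sup>2) \<longlonglongrightarrow> 0"
    by (rule summable_LIMSEQ_zero)
  then have "eventually (\<lambda>n. (\<phi> (f n))\<^sup>2 < 1) sequentially"
    by (rule order_tendstoD) simp
  \<comment> \<open>Once the values are below 1 in modulus, an exponent \<open>p \<ge> 2\<close>
    gives at most the square, so the series of squares dominates.\<close>
  then have "eventually (\<lambda>n. norm (\<bar>\<phi> (f n)\<bar> powr p) \<le> (\<phi> (f n))\<^sup>2) sequentially"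
  proof eventually_elim
    case (elim n)
    then have "\<bar>\<phi> (f n)\<bar> \<le> 1"
      by (simp add: abs_square_less_1 less_imp_le)
    then have "\<bar>\<phi> (f n)\<bar> powr p \<le> \<bar>\<phi> (f n)\<bar> powr 2"
      using \<open>2 \<le> p\<close> by (intro powr_mono') auto
    also have "\<dots> = (\<phi> (f n))\<^sup>2"
      by (cases "\<phi> (f n) = 0") (simp_all add: powr_numeral)
    finally show ?case by simp
  qed
  then show "summable (\<lambda>n. \<bar>\<phi> (f n)\<bar> powr p)"
    by (rule summable_comparison_test_ev[OF _ sq])
qed

section \<open>Application to weakly Cauchy subsequences\<close>

lemma divergent_unit_functional:
  fixes x :: "nat \<Rightarrow> 'a::real_normed_vector"
  assumes "\<not> weakly_Cauchy x"
  obtains g :: "'a \<Rightarrow>\<^sub>L real" where "norm g \<le> 1" "\<not> convergent (\<lambda>n. g (x n))"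
proof -
  obtain f :: "'a \<Rightarrow>\<^sub>L real" where f: "\<not> Cauchy (\<lambda>n. f (x n))"
    using assms by (auto simp: weakly_Cauchy_def)
  \<comment> \<open>Scaling into the unit ball makes the values along a bounded sequence uniformly
    bounded, as the dichotomy requires. For \<open>f = 0\<close>, division by zero gives
    \<open>g = 0\<close>, and the identity with the factor \<open>norm f\<close> still
    holds.\<close>
  define g where "g = (1 / norm f) *\<^sub>R f"
  have "(\<lambda>n. f (x n)) = (\<lambda>n. norm f * g (x n))"
    by (cases "f = 0") (auto simp: g_def blinfun.scaleR_left)
  then have "\<not> convergent (\<lambda>n. g (x n))"
    using f convergent_mult[OF convergent_const[of "norm f"]] convergent_Cauchy by metis
  moreover have "norm g \<le> 1" by (simp add: g_def)
  ultimately show thesis using that by blast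
qed

theorem corollary17:
  fixes p :: real and A :: "'a::banach set"
  assumes "2 < p"
    and "weakly_p_Dunford_Pettis p A"
  shows "weakly_precompact A"
  unfolding weakly_precompact_def
proof (intro allI impI, rule ccontr)
  fix x :: "nat \<Rightarrow> 'a"
  assume x: "\<forall>n. x n \<in> A"
    and no: "\<not> (\<exists>r. strict_mono r \<and> weakly_Cauchy (x \<circ> r))"
  obtain B where B: "\<And>n. norm (x n) \<le> B"
    using assms(2) x by (auto simp: weakly_p_Dunford_Pettis_def bounded_iff)
  let ?T = "{g :: 'a \<Rightarrow>\<^sub>L real. norm g \<le> 1}"
  have bound: "\<bar>blinfun_apply g (x n)\<bar> \<le> B" if "g \<in> ?T" for n g
  proof -
    have "norm (blinfun_apply g (x n)) \<le> norm g * norm (x n)" by (rule norm_blinfun)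
    also have "\<dots> \<le> 1 * B" using that B by (intro mult_mono) auto
    finally show ?thesis by simp
  qed
  have div: "\<exists>g\<in>?T. \<not> convergent (\<lambda>n. blinfun_apply g (x (r n)))" if r: "strict_mono r" for r
  proof -
    have "\<not> weakly_Cauchy (x \<circ> r)" using no r by blast
    then obtain g :: "'a \<Rightarrow>\<^sub>L real" where "norm g \<le> 1" "\<not> convergent (\<lambda>n. g ((x \<circ> r) n))"
      by (rule divergent_unit_functional)
    then show ?thesis by auto
  qed
  \<comment> \<open>The terms \<open>x n\<close> act as functions on the dual unit ball; a
    subsequence converging pointwise there would be weakly Cauchy.\<close>
  obtain a b :: real and u :: "nat \<Rightarrow> nat" where "a < b" and "strict_mono u"
    and indep: "\<And>k S. \<exists>g\<in>?T. \<forall>i<k. if i \<in> S then blinfun_apply g (x (u i)) > b else blinfun_apply g (x (u i)) < a"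
    by (rule Rosenthal_independent_subsequence[of ?T "\<lambda>n g. blinfun_apply g (x n)", OF bound div])
      (assumption, assumption, rule that)
  have "\<exists>g :: 'a \<Rightarrow>\<^sub>L real. norm g \<le> 1 \<and>
      (\<forall>i<k. if i \<in> S then b < blinfun_apply g ((x \<circ> u) i) else blinfun_apply g ((x \<circ> u) i) < a)" for k S
    using indep[of k S] by auto
  then obtain f :: "nat \<Rightarrow> ('a \<Rightarrow>\<^sub>L real)" where
    f2: "\<And>N c x. (\<Sum>n<N. c n * f n x)\<^sup>2 \<le> (\<Sum>n<N. (c n)\<^sup>2) * (norm x)\<^sup>2"
    and fy: "\<And>n. f n ((x \<circ> u) n) \<ge> (b - a) / 2"
    by (rule weakly_2_summable_limit) (rule that)
  have "weakly_p_summable p f"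
    using \<open>2 < p\<close> by (intro weakly_p_summableI f2) simp
  then have "(\<lambda>n. SUP x\<in>A. ennreal \<bar>f n x\<bar>) \<longlonglongrightarrow> 0"
    using assms(2) by (simp add: weakly_p_Dunford_Pettis_def)
  moreover have "0 < ennreal ((b - a) / 2)"
    using \<open>a < b\<close> by simp
  ultimately have "eventually (\<lambda>n. (SUP x\<in>A. ennreal \<bar>f n x\<bar>) < ennreal ((b - a) / 2)) sequentially"
    by (rule order_tendstoD)
  then obtain n where n: "(SUP x\<in>A. ennreal \<bar>f n x\<bar>) < ennreal ((b - a) / 2)"
    by (auto dest: eventually_happens)
  have "ennreal ((b - a) / 2) \<le> ennreal \<bar>f n ((x \<circ> u) n)\<bar>"
    using fy[of n] by (intro ennreal_leI) simp
  also have "\<dots> \<le> (SUP x\<in>A. ennreal \<bar>f n x\<bar>)"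
    using x by (intro SUP_upper) simp
  finally show False using n by simp
qed

end
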